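(* Let $G\colon\mathbb{R}^n\to\mathbb{S}^m$ be continuously differentiable and let $\bar{x}\in\mathbb{R}^n$ satisfy $G(\bar{x})\succeq0$. If $\bar{x}$ satisfies sparse-nondegeneracy, then it also satisfies Robinson's CQ.
   Context: $\mathbb{S}^m$ is the space of real symmetric $m\times m$ matrices; $M\succeq 0$ means that $M$ is positive semidefinite. $D_{x_\ell}G(x)\in\mathbb{S}^m$ are the partial derivatives of $G$ and $DG(x)[d]=\sum_{\ell=1}^n d_\ell D_{x_\ell}G(x)$. Robinson's CQ holds at $\bar{x}$ if there exists $d\in\mathbb{R}^n$ such that $G(\bar{x})+DG(\bar{x})[d]$ is positive definite. For a function $F\colon\mathbb{R}^n\to\mathbb{S}^\beta$, let $$\mathcal{I}(F,\bar{x})=\{(i,j) : 1\le i\le j\le\beta,\ \forall\varepsilon>0\ \exists x\in B(\bar{x},\varepsilon)\text{ such that }F_{ij}(x)\neq0\},$$ where $B(\bar{x},\varepsilon)$ is the ball centred at $\bar{x}$ with radius $\varepsilon$. Let $r=\operatorname{rank}(G(\bar{x}))$. A matrix $\bar{E}\in\mathbb{R}^{m\times(m-r)}$ is said to span $\operatorname{Ker}G(\bar{x})$ if $\bar{E}^\top\bar{E}=I_{m-r}$ and $G(\bar{x})\bar{E}=0$. With columns $\bar{e}_1,\ldots,\bar{e}_{m-r}$ of $\bar{E}$, set $v_{ij}(\bar{x},\bar{E})=[\bar{e}_i^\top D_{x_1}G(\bar{x})\bar{e}_j,\ldots,\bar{e}_i^\top D_{x_n}G(\bar{x})\bar{e}_j]^\top\in\mathbb{R}^n$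 and $\widehat{G}^{\bar{E}}(x)=\bar{E}^\top G(x)\bar{E}$. Sparse-nondegeneracy holds at $\bar{x}$ if either $\operatorname{Ker}G(\bar{x})=\{0\}$ or there exists a matrix $\bar{E}\in\mathbb{R}^{m\times(m-r)}$ that spans $\operatorname{Ker}G(\bar{x})$ such that: (1) the family $\{v_{ij}(\bar{x},\bar{E}) : (i,j)\in\mathcal{I}(\widehat{G}^{\bar{E}},\bar{x}),\ 1\le i\le j\le m-r\}$ is linearly independent (as an indexed family); and (2) $(i,i)\in\mathcal{I}(\widehat{G}^{\bar{E}},\bar{x})$ for all $i\in\{1,\ldots,m-r\}$. *)

theory Defs
  imports "HOL-Analysis.Analysis"
begin

definition symmetric_matrix :: "real^'m^'m \<Rightarrow> bool" where
  "symmetric_matrix A \<longleftrightarrow> transpose A = A"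

definition positive_semidefinite :: "real^'m^'m \<Rightarrow> bool" where
  "positive_semidefinite A \<longleftrightarrow> symmetric_matrix A \<and> (\<forall>v. 0 \<le> v \<bullet> (A *v v))"

definition positive_definite :: "real^'m^'m \<Rightarrow> bool" where
  "positive_definite A \<longleftrightarrow> symmetric_matrix A \<and> (\<forall>v. v \<noteq> 0 \<longrightarrow> 0 < v \<bullet> (A *v v))"

definition continuously_differentiable ::
    "('a::real_normed_vector \<Rightarrow> 'b::real_normed_vector) \<Rightarrow> bool" where
  "continuously_differentiable f \<longleftrightarrow>
     (\<exists>f' :: 'a \<Rightarrow> 'a \<Rightarrow>\<^sub>L 'b.
        (\<forall>x. (f has_derivative blinfun_apply (f' x)) (at x)) \<and> continuous_on UNIV f')"

definition partial_derivative ::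
    "(real^'n \<Rightarrow> 'b::real_normed_vector) \<Rightarrow> 'n \<Rightarrow> real^'n \<Rightarrow> 'b" where
  "partial_derivative G l x = vector_derivative (\<lambda>t. G (x + t *\<^sub>R axis l 1)) (at 0)"

definition total_derivative ::
    "(real^'n \<Rightarrow> 'b::real_normed_vector) \<Rightarrow> real^'n \<Rightarrow> real^'n \<Rightarrow> 'b" where
  "total_derivative G x d = (\<Sum>l\<in>UNIV. (d $ l) *\<^sub>R partial_derivative G l x)"

definition robinson_cq :: "(real^'n \<Rightarrow> real^'m^'m) \<Rightarrow> real^'n \<Rightarrow> bool" where
  "robinson_cq G xbar \<longleftrightarrow> (\<exists>d. positive_definite (G xbar + total_derivative G xbar d))"

text \<open>
  The order \<open>\<beta>\<close> of the matrix function \<open>F\<close> below, and the number of columns of \<open>E\<close>, will be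
  \<open>m - rank (G xbar)\<close>, which depends on a term and hence cannot be a type. Therefore a
  \<open>\<beta> \<times> \<beta>\<close> matrix is a function of two indices in \<open>{1..\<beta>}\<close>, and a matrix \<open>E\<close> with
  \<open>k\<close> columns in \<open>real^'m\<close> is a function sending \<open>j \<in> {1..k}\<close> to its \<open>j\<close>-th column;
  values at other indices are irrelevant.
\<close>

definition nonzero_pattern ::
    "nat \<Rightarrow> ('a::metric_space \<Rightarrow> nat \<Rightarrow> nat \<Rightarrow> real) \<Rightarrow> 'a \<Rightarrow> (nat \<times> nat) set" where
  "nonzero_pattern \<beta> F xbar =
     {(i, j). 1 \<le> i \<and> i \<le> j \<and> j \<le> \<beta> \<and> (\<forall>\<epsilon>>0. \<exists>x\<in>ball xbar \<epsilon>. F x i j \<noteq> 0)}"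

text \<open>The two conditions are \<open>E\<^sup>T E = I\<close> and \<open>A E = 0\<close>, with \<open>k\<close> the number of columns of \<open>E\<close>.\<close>

definition spans_kernel :: "nat \<Rightarrow> (nat \<Rightarrow> real^'m) \<Rightarrow> real^'m^'m \<Rightarrow> bool" where
  "spans_kernel k E A \<longleftrightarrow>
     (\<forall>i\<in>{1..k}. \<forall>j\<in>{1..k}. E i \<bullet> E j = (if i = j then 1 else 0)) \<and>
     (\<forall>j\<in>{1..k}. A *v E j = 0)"

definition v_vec ::
    "(real^'n \<Rightarrow> real^'m^'m) \<Rightarrow> real^'n \<Rightarrow> (nat \<Rightarrow> real^'m) \<Rightarrow> nat \<Rightarrow> nat \<Rightarrow> real^'n" where
  "v_vec G xbar E i j = (\<chi> l. E i \<bullet> (partial_derivative G l xbar *v E j))"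

definition G_hat ::
    "(real^'n \<Rightarrow> real^'m^'m) \<Rightarrow> (nat \<Rightarrow> real^'m) \<Rightarrow> real^'n \<Rightarrow> nat \<Rightarrow> nat \<Rightarrow> real" where
  "G_hat G E x i j = E i \<bullet> (G x *v E j)"

text \<open>\<^const>\<open>independent\<close> speaks about sets, so injectivity is needed to exclude repeated members.\<close>

definition independent_family :: "'i set \<Rightarrow> ('i \<Rightarrow> 'b::real_vector) \<Rightarrow> bool" where
  "independent_family I v \<longleftrightarrow> inj_on v I \<and> independent (v ` I)"

definition sparse_nondegeneracy :: "(real^'n \<Rightarrow> real^'m^'m) \<Rightarrow> real^'n \<Rightarrow> bool" where
  "sparse_nondegeneracy G xbar \<longleftrightarrow>
     {v. G xbar *v v = 0} = {0} \<or>
     (let k = CARD('m) - rank (G xbar) in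
      \<exists>E. spans_kernel k E (G xbar) \<and>
          independent_family (nonzero_pattern k (G_hat G E) xbar) (\<lambda>(i, j). v_vec G xbar E i j) \<and>
          (\<forall>i\<in>{1..k}. (i, i) \<in> nonzero_pattern k (G_hat G E) xbar))"

end

theory Submission
  imports Defs
begin

text \<open>
  Linear independence of the \<open>v\<^sub>i\<^sub>j\<close> in the nonzero pattern gives a direction \<open>d\<close> with
  \<open>v\<^sub>i\<^sub>j \<bullet> d = 1\<close> for \<open>i = j\<close> and \<open>0\<close> otherwise. An entry outside the pattern vanishes near
  \<open>xbar\<close>, so its gradient \<open>v\<^sub>i\<^sub>j\<close> is zero, and it lies off the diagonal by the second condition.
  Hence \<open>E\<^sup>T DG(xbar)[d] E = I\<close>, that is, \<open>DG(xbar)[d]\<close> is positive definite on the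
  kernel of the positive semidefinite matrix \<open>G(xbar)\<close>; by compactness of the unit sphere,
  \<open>G(xbar) + t DG(xbar)[d]\<close> is then positive definite for some \<open>t > 0\<close>.
\<close>

section \<open>Symmetric matrices and kernels\<close>

lemma symmetric_matrix_inner_commute:
  fixes A :: "real^'m^'m"
  assumes "symmetric_matrix A"
  shows "u \<bullet> (A *v w) = w \<bullet> (A *v u)"
proof -
  have "u \<bullet> (A *v w) = (u v* transpose A) \<bullet> w"
    using assms by (simp add: symmetric_matrix_def dot_lmul_matrix)
  then show ?thesis
    by (simp add: inner_commute)
qed

lemma linear_inner_matrix_vector: "linear (\<lambda>M :: real^'m^'m. u \<bullet> (M *v w))"
  by (rule linearI)
    (simp_all add: matrix_vector_mult_add_rdistrib inner_add_right scaleR_matrix_vector_assoc [symmetric])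

lemma linear_transpose: "linear (transpose :: real^'m^'n \<Rightarrow> real^'n^'m)"
  by (rule linearI) (simp_all add: transpose_def vec_eq_iff)

text \<open>Rank-nullity: the kernel is the orthogonal complement of the row space, whose dimension
  is \<open>rank A\<close>.\<close>

lemma dim_nullspace:
  fixes A :: "real^'n^'m"
  shows "dim {v. A *v v = 0} = CARD('n) - rank A"
proof -
  have "{v. A *v v = 0} = {v \<in> UNIV. \<forall>u\<in>span (rows A). orthogonal u v}"
  proof safe
    fix v u
    assume "A *v v = 0" "u \<in> span (rows A)"
    then show "orthogonal u v"
      using orthogonal_nullspace_rowspace orthogonal_commute by blast
  next
    fix v
    assume orth: "\<forall>u\<in>span (rows A). orthogonal u v"
    have "(A *v v) $ i = 0" for i
    proof -
      have "row i A \<in> span (rows A)"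
        by (auto simp: rows_def intro: span_base)
      then show ?thesis
        using orth by (simp add: orthogonal_def matrix_vector_mul_component row_def)
    qed
    then show "A *v v = 0"
      by (simp add: vec_eq_iff)
  qed simp_all
  moreover have "dim {v \<in> (UNIV :: (real^'n) set). \<forall>u\<in>span (rows A). orthogonal u v}
      + dim (span (rows A)) = CARD('n)"
    using dim_subspace_orthogonal_to_vectors [of "span (rows A)" "UNIV :: (real^'n) set"]
    by (simp add: subspace_span)
  ultimately show ?thesis
    by (simp add: row_rank_def)
qed

text \<open>Orthonormal vectors are independent, and there are exactly as many of them as the
  dimension of the kernel in which they lie. This justifies the name
  \<open>spans_kernel\<close>.\<close>

lemma spans_kernel_span:
  fixes A :: "real^'m^'m"
  assumes "spans_kernel (CARD('m) - rank A) E A"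
  shows "{v. A *v v = 0} \<subseteq> span (E ` {1..CARD('m) - rank A})"
proof -
  let ?I = "{1..CARD('m) - rank A}"
  have E: "\<And>i j. i \<in> ?I \<Longrightarrow> j \<in> ?I \<Longrightarrow> E i \<bullet> E j = (if i = j then 1 else 0)"
    and ker: "\<And>j. j \<in> ?I \<Longrightarrow> A *v E j = 0"
    using assms by (auto simp: spans_kernel_def)
  have "inj_on E ?I"
    by (rule inj_onI) (metis E zero_neq_one)
  then have "card (E ` ?I) = CARD('m) - rank A"
    by (simp add: card_image)
  moreover have "independent (E ` ?I)"
  proof (rule pairwise_orthogonal_independent)
    show "pairwise orthogonal (E ` ?I)"
      unfolding pairwise_def orthogonal_def using E by fastforce
    show "0 \<notin> E ` ?I"
      using E by (metis imageE inner_zero_left zero_neq_one)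
  qed
  ultimately show ?thesis
    using ker by (intro card_ge_dim_independent) (auto simp: dim_nullspace)
qed

text \<open>If \<open>A *v v\<close> were nonzero, a move from \<open>v\<close> against this vector
  would make the quadratic form negative.\<close>

lemma positive_semidefinite_kernel:
  fixes A :: "real^'m^'m"
  assumes "positive_semidefinite A" and "v \<bullet> (A *v v) = 0"
  shows "A *v v = 0"
proof (rule ccontr)
  assume "A *v v \<noteq> 0"
  define w where "w = A *v v"
  define a where "a = w \<bullet> w"
  define b where "b = w \<bullet> (A *v w)"
  \<comment> \<open>The form at \<open>v + s *\<^sub>R w\<close> equals
    \<open>s * (2 * a + s * b)\<close>, so a small negative \<open>s\<close> is wanted. The
    \<open>+ 1\<close> keeps the denominator positive when \<open>b = 0\<close>.\<close>
  define s where "s = - a / (b + 1)"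
  have sym: "symmetric_matrix A" and nonneg: "\<And>u. 0 \<le> u \<bullet> (A *v u)"
    using assms(1) by (auto simp: positive_semidefinite_def)
  have "a > 0"
    using \<open>A *v v \<noteq> 0\<close> by (simp add: a_def w_def)
  have "b \<ge> 0"
    using nonneg by (simp add: b_def)
  have "v \<bullet> (A *v w) = a"
    using symmetric_matrix_inner_commute [OF sym, of v w] by (simp add: a_def w_def)
  then have "(v + s *\<^sub>R w) \<bullet> (A *v (v + s *\<^sub>R w)) = 2 * s * a + s\<^sup>2 * b"
    using assms(2)
    by (simp add: matrix_vector_right_distrib matrix_vector_mult_scaleR inner_add_left
        inner_add_right b_def power2_eq_square w_def [symmetric] a_def [symmetric] algebra_simps)
  also have "\<dots> = s * (a + (a + s * b))"
    by (simp add: algebra_simps power2_eq_square)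
  also have "\<dots> < 0"
  proof (rule mult_neg_pos)
    show "s < 0"
      using \<open>a > 0\<close> \<open>b \<ge> 0\<close> by (simp add: s_def divide_neg_pos)
    have "a + s * b = a / (b + 1)"
      using \<open>b \<ge> 0\<close> by (simp add: s_def field_simps)
    then show "0 < a + (a + s * b)"
      using \<open>a > 0\<close> \<open>b \<ge> 0\<close> by (simp add: add_pos_pos)
  qed
  finally show False
    using nonneg [of "v + s *\<^sub>R w"] by simp
qed

section \<open>Positivity under a small perturbation\<close>

lemma compact_pos_perturbation:
  fixes f g :: "'a::topological_space \<Rightarrow> real"
  assumes "compact S" and "continuous_on S f" and "continuous_on S g"
    and nonneg: "\<And>x. x \<in> S \<Longrightarrow> 0 \<le> f x"
    and pos: "\<And>x. x \<in> S \<Longrightarrow> f x = 0 \<Longrightarrow> 0 < g x"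
  obtains t where "t > 0" "\<And>x. x \<in> S \<Longrightarrow> 0 < f x + t * g x"
proof -
  have "\<exists>t>0. \<forall>x\<in>S. 0 < f x + t * g x"
  proof (cases "S = {}")
    case False
    \<comment> \<open>\<open>max f g\<close> is positive on \<open>S\<close>, hence bounded below by some \<open>c > 0\<close>; where \<open>f < c\<close> we have \<open>g \<ge> c\<close>.\<close>
    obtain y where y: "y \<in> S" "\<And>x. x \<in> S \<Longrightarrow> max (f y) (g y) \<le> max (f x) (g x)"
      using continuous_attains_inf [OF \<open>compact S\<close> False, of "\<lambda>x. max (f x) (g x)"] assms(2,3)
      by (auto intro: continuous_on_max)
    obtain z where z: "z \<in> S" "\<And>x. x \<in> S \<Longrightarrow> g z \<le> g x"
      using continuous_attains_inf [OF \<open>compact S\<close> False assms(3)] by auto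
    define c where "c = max (f y) (g y)"
    \<comment> \<open>Since \<open>g z\<close> is the minimum of \<open>g\<close>, the loss
      \<open>t * - g x\<close> is at most \<open>c / 2\<close> everywhere, less than
      \<open>f x\<close> wherever \<open>f x\<close> is at least \<open>c\<close>.\<close>
    define t where "t = c / (2 * (\<bar>g z\<bar> + 1))"
    have "c > 0"
      using nonneg [OF y(1)] pos [OF y(1)] by (cases "f y = 0") (auto simp: c_def)
    have "t > 0"
      using \<open>c > 0\<close> by (simp add: t_def)
    have t: "t * (\<bar>g z\<bar> + 1) = c / 2"
      by (simp add: t_def field_simps)
    have "0 < f x + t * g x" if "x \<in> S" for x
    proof (cases "g x > 0")
      case True
      then show ?thesis
        using nonneg [OF that] \<open>t > 0\<close> by (simp add: add_nonneg_pos)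
    next
      case False
      then have "c \<le> f x"
        using y(2) [OF that] \<open>c > 0\<close> by (auto simp: c_def [symmetric])
      moreover have "t * - g x \<le> t * (\<bar>g z\<bar> + 1)"
        using z(2) [OF that] \<open>t > 0\<close> by (intro mult_left_mono) auto
      ultimately show ?thesis
        using t \<open>c > 0\<close> by simp
    qed
    then show ?thesis
      using \<open>t > 0\<close> by blast
  qed (auto intro: exI [of _ 1])
  then show ?thesis
    using that by blast
qed

text \<open>Quadratic forms are homogeneous of degree two, so the compact unit sphere suffices.
  There the form of \<open>A\<close> vanishes only at kernel vectors, where \<open>H\<close> is
  positive.\<close>

lemma positive_definite_perturbation:
  fixes A H :: "real^'m^'m"
  assumes "positive_semidefinite A" and "symmetric_matrix H"
    and pos: "\<And>v. A *v v = 0 \<Longrightarrow> v \<noteq> 0 \<Longrightarrow> 0 < v \<bullet> (H *v v)"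
  obtains t where "t > 0" "positive_definite (A + t *\<^sub>R H)"
proof -
  have quad: "continuous_on (sphere 0 1) (\<lambda>v. v \<bullet> (M *v v))" for M :: "real^'m^'m"
    by (intro continuous_intros)
  obtain t where "t > 0"
    and t: "\<And>v. v \<in> sphere 0 1 \<Longrightarrow> 0 < v \<bullet> (A *v v) + t * (v \<bullet> (H *v v))"
  proof (rule compact_pos_perturbation [OF compact_sphere quad [of A] quad [of H]])
    show "0 \<le> v \<bullet> (A *v v)" for v
      using assms(1) by (simp add: positive_semidefinite_def)
    show "0 < v \<bullet> (H *v v)" if "v \<in> sphere 0 1" "v \<bullet> (A *v v) = 0" for v
      using positive_semidefinite_kernel [OF assms(1) that(2)] that(1)
      by (intro pos) auto
  qed (rule that)
  have "symmetric_matrix (A + t *\<^sub>R H)"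
    using assms(1,2)
    by (simp add: positive_semidefinite_def symmetric_matrix_def linear_add [OF linear_transpose]
        linear_scale [OF linear_transpose])
  moreover have "0 < v \<bullet> ((A + t *\<^sub>R H) *v v)" if "v \<noteq> 0" for v
  proof -
    define u where "u = v /\<^sub>R norm v"
    have "v = norm v *\<^sub>R u" and "u \<in> sphere 0 1"
      using that by (simp_all add: u_def)
    have "v \<bullet> ((A + t *\<^sub>R H) *v v) = v \<bullet> (A *v v) + t * (v \<bullet> (H *v v))"
      by (simp add: matrix_vector_mult_add_rdistrib inner_add_right
          scaleR_matrix_vector_assoc [symmetric])
    also have "\<dots> = (norm v)\<^sup>2 * (u \<bullet> (A *v u) + t * (u \<bullet> (H *v u)))"
      by (subst (1 2 3 4) \<open>v = norm v *\<^sub>R u\<close>)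
        (simp add: matrix_vector_mult_scaleR power2_eq_square algebra_simps)
    also have "\<dots> > 0"
      using t [OF \<open>u \<in> sphere 0 1\<close>] that by simp
    finally show ?thesis .
  qed
  ultimately have "positive_definite (A + t *\<^sub>R H)"
    by (simp add: positive_definite_def)
  with \<open>t > 0\<close> show ?thesis
    by (rule that)
qed

section \<open>Solving linear conditions for a direction\<close>

text \<open>A linear functional may take any values on an independent set, and
  \<open>adjoint f 1\<close> is the vector that represents it. Injectivity lets the values depend on
  the index.\<close>

lemma independent_family_prescribed_inner:
  fixes v :: "'i \<Rightarrow> 'a::euclidean_space"
  assumes "independent_family I v"
  obtains d where "\<And>i. i \<in> I \<Longrightarrow> v i \<bullet> d = c i"
proof -
  have inj: "inj_on v I" and ind: "independent (v ` I)"
    using assms by (auto simp: independent_family_def)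
  obtain f :: "'a \<Rightarrow> real"
    where f: "linear f" "\<And>x. x \<in> v ` I \<Longrightarrow> f x = c (inv_into I v x)"
    using linear_independent_extend [OF ind, of "\<lambda>x. c (inv_into I v x)"] by blast
  have "v i \<bullet> adjoint f 1 = c i" if "i \<in> I" for i
    using adjoint_works [OF f(1), of "v i" 1] f(2) [of "v i"] that inj
    by simp
  then show ?thesis
    by (rule that)
qed

section \<open>Derivatives of a matrix function and of its entries\<close>

lemma partial_derivative_eq:
  assumes "(G has_derivative G') (at x)"
  shows "partial_derivative G l x = G' (axis l 1)"
proof -
  interpret G': bounded_linear G'
    by (rule has_derivative_bounded_linear [OF assms])
  have "((\<lambda>t. x + t *\<^sub>R axis l 1) has_derivative (\<lambda>t. t *\<^sub>R axis l 1)) (at (0::real))"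
    by (auto intro!: derivative_eq_intros)
  moreover have "(G has_derivative G') (at (x + 0 *\<^sub>R axis l 1))"
    using assms by simp
  ultimately have "((\<lambda>t. G (x + t *\<^sub>R axis l 1)) has_derivative (\<lambda>t. G' (t *\<^sub>R axis l 1))) (at (0::real))"
    by (rule has_derivative_compose)
  then have "((\<lambda>t. G (x + t *\<^sub>R axis l 1)) has_vector_derivative G' (axis l 1)) (at 0)"
    by (simp add: has_vector_derivative_def G'.scaleR)
  then show ?thesis
    by (simp add: partial_derivative_def vector_derivative_at)
qed

lemma total_derivative_eq:
  assumes "(G has_derivative G') (at x)"
  shows "total_derivative G x d = G' d"
proof -
  interpret G': bounded_linear G'
    by (rule has_derivative_bounded_linear [OF assms])
  have "total_derivative G x d = G' (\<Sum>l\<in>UNIV. d $ l *\<^sub>R axis l 1)"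
    by (simp add: total_derivative_def partial_derivative_eq [OF assms] G'.sum G'.scaleR)
  then show ?thesis
    using basis_expansion [of d] by (simp add: scalar_mult_eq_scaleR)
qed

lemma has_derivative_locally_zero:
  assumes "(f has_derivative f') (at x)" and "\<epsilon> > 0" and "\<And>y. y \<in> ball x \<epsilon> \<Longrightarrow> f y = 0"
  shows "f' = (\<lambda>_. 0)"
proof -
  have "((\<lambda>_. 0) has_derivative f') (at x)"
    using assms by (intro has_derivative_transform_within_open [OF assms(1), of "ball x \<epsilon>"]) auto
  then show ?thesis
    using has_derivative_const by (rule has_derivative_unique)
qed

text \<open>\<open>v_vec\<close> is the gradient of the entry \<open>(i, j)\<close> of
  \<open>G_hat\<close>; its inner product with \<open>d\<close> is the directional derivative of
  that entry.\<close>

lemma inner_v_vec: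
  assumes "(G has_derivative G') (at x)"
  shows "v_vec G x E i j \<bullet> d = E i \<bullet> (G' d *v E j)"
proof -
  have "E i \<bullet> (G' d *v E j) = (\<Sum>l\<in>UNIV. E i \<bullet> (((d $ l) *\<^sub>R partial_derivative G l x) *v E j))"
    unfolding total_derivative_eq [OF assms, symmetric] total_derivative_def
    by (rule linear_sum [OF linear_inner_matrix_vector])
  also have "\<dots> = (\<Sum>l\<in>UNIV. d $ l * (E i \<bullet> (partial_derivative G l x *v E j)))"
    by (simp add: scaleR_matrix_vector_assoc [symmetric])
  finally show ?thesis
    by (simp add: v_vec_def inner_vec_def mult.commute)
qed

section \<open>A direction whose derivative acts as the identity form on the kernel\<close>

theorem proposition4p2:
  fixes G :: "real^'n \<Rightarrow> real^'m^'m" and xbar :: "real^'n"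
  assumes "\<And>x. symmetric_matrix (G x)"
    and "continuously_differentiable G"
    and "positive_semidefinite (G xbar)"
    and "sparse_nondegeneracy G xbar"
  shows "robinson_cq G xbar"
proof -
  define A where "A = G xbar"
  define k where "k = CARD('m) - rank A"
  obtain G' where G': "(G has_derivative G') (at xbar)"
    using assms(2) unfolding continuously_differentiable_def by metis
  \<comment> \<open>Transposition is linear and fixes \<open>G\<close>, so by uniqueness it fixes
    the derivative.\<close>
  have sym: "symmetric_matrix (G' d)" for d
  proof -
    have "((\<lambda>x. transpose (G x)) has_derivative (\<lambda>d. transpose (G' d))) (at xbar)"
      using linear_transpose unfolding linear_conv_bounded_linear
      by (rule bounded_linear.has_derivative) (rule G')
    moreover have "(\<lambda>x. transpose (G x)) = G"
      using assms(1) by (simp add: symmetric_matrix_def)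
    ultimately have "(\<lambda>d. transpose (G' d)) = G'"
      using G' has_derivative_unique by metis
    then show ?thesis
      by (metis symmetric_matrix_def)
  qed
  have "\<exists>d. \<forall>v. A *v v = 0 \<longrightarrow> v \<noteq> 0 \<longrightarrow> 0 < v \<bullet> (G' d *v v)"
  \<comment> \<open>For a trivial kernel the claim is vacuous and any \<open>d\<close> will
    do.\<close>
  proof (cases "{v. A *v v = 0} = {0}")
    case False
    let ?N = "\<lambda>E. nonzero_pattern k (G_hat G E) xbar"
    obtain E where E: "spans_kernel k E A"
      and ind: "independent_family (?N E) (\<lambda>(i, j). v_vec G xbar E i j)"
      and diag: "\<And>i. i \<in> {1..k} \<Longrightarrow> (i, i) \<in> ?N E"
      using assms(4) False unfolding sparse_nondegeneracy_def Let_def A_def k_def by blast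
    obtain d where d: "\<And>p. p \<in> ?N E \<Longrightarrow>
        (case p of (i, j) \<Rightarrow> v_vec G xbar E i j) \<bullet> d = (if fst p = snd p then 1 else 0)"
      by (rule independent_family_prescribed_inner
            [OF ind, where c = "\<lambda>p. if fst p = snd p then 1 else 0"]) (rule that)
    have off: "E i \<bullet> (G' d *v E j) = 0" if out: "1 \<le> i" "i \<le> j" "j \<le> k" "(i, j) \<notin> ?N E" for i j
    proof -
      obtain \<epsilon> where "\<epsilon> > 0" "\<And>x. x \<in> ball xbar \<epsilon> \<Longrightarrow> E i \<bullet> (G x *v E j) = 0"
        using out unfolding nonzero_pattern_def G_hat_def by blast
      moreover have "((\<lambda>x. E i \<bullet> (G x *v E j)) has_derivative (\<lambda>h. E i \<bullet> (G' h *v E j))) (at xbar)"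
        using linear_inner_matrix_vector unfolding linear_conv_bounded_linear
        by (rule bounded_linear.has_derivative) (rule G')
      ultimately have "(\<lambda>h. E i \<bullet> (G' h *v E j)) = (\<lambda>_. 0)"
        using has_derivative_locally_zero by blast
      then show ?thesis
        by metis
    qed
    \<comment> \<open>With \<open>E i \<bullet> E j\<close> in place of a Kronecker delta both sides
      are bilinear in the columns, so the identity can pass to their span.\<close>
    have upper: "E i \<bullet> (G' d *v E j) = E i \<bullet> E j" if "1 \<le> i" "i \<le> j" "j \<le> k" for i j
    proof -
      have "E i \<bullet> (G' d *v E j) = (if i = j then 1 else 0)"
        using d [of "(i, j)"] off [OF that] diag [of i] that
        by (cases "(i, j) \<in> ?N E") (auto simp: inner_v_vec [OF G'])
      also have "\<dots> = E i \<bullet> E j"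
        using E that by (auto simp: spans_kernel_def)
      finally show ?thesis .
    qed
    \<comment> \<open>The pattern records only pairs with \<open>i \<le> j\<close>; symmetry of
      \<open>G' d\<close> supplies the others.\<close>
    have all: "E i \<bullet> (G' d *v E j) = E i \<bullet> E j" if "i \<in> {1..k}" "j \<in> {1..k}" for i j
      using upper [of i j] upper [of j i] that symmetric_matrix_inner_commute [OF sym]
      by (cases "i \<le> j") (auto simp: inner_commute)
    \<comment> \<open>Span induction extends the identity one argument at a time: \<open>row\<close>
      treats the second, \<open>form\<close> the first after a swap by symmetry.\<close>
    have subsp: "subspace {w. u \<bullet> (G' d *v w) = u \<bullet> w}" for u
      by (auto simp: subspace_def matrix_vector_right_distrib inner_add_right
          matrix_vector_mult_scaleR)
    have row: "E i \<bullet> (G' d *v w) = E i \<bullet> w" if "i \<in> {1..k}" "w \<in> span (E ` {1..k})" for i w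
      using that(2) by (induction rule: span_induct) (use subsp all that(1) in auto)
    have form: "w \<bullet> (G' d *v u) = w \<bullet> u"
      if "w \<in> span (E ` {1..k})" "u \<in> span (E ` {1..k})" for u w
    proof -
      have "u \<bullet> (G' d *v w) = u \<bullet> w"
        using that(1)
      proof (induction rule: span_induct)
        case (step x)
        then show ?case
          using row that(2) symmetric_matrix_inner_commute [OF sym] inner_commute by (metis imageE)
      qed (rule subsp)
      then show ?thesis
        using symmetric_matrix_inner_commute [OF sym] inner_commute by metis
    qed
    have "0 < v \<bullet> (G' d *v v)" if "A *v v = 0" "v \<noteq> 0" for v
    proof -
      have "v \<in> span (E ` {1..k})"
        using spans_kernel_span [of A E] E that(1) by (auto simp: k_def)
      then show ?thesis
        using form that(2) by simp
    qed
    then show ?thesis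
      by blast
  qed auto
  then obtain d where d: "\<And>v. A *v v = 0 \<Longrightarrow> v \<noteq> 0 \<Longrightarrow> 0 < v \<bullet> (G' d *v v)"
    by blast
  obtain t where "positive_definite (A + t *\<^sub>R G' d)"
    using positive_definite_perturbation [OF _ sym d] assms(3) A_def by metis
  \<comment> \<open>By linearity the factor \<open>t\<close> is absorbed into the direction, so
    \<open>t *\<^sub>R d\<close> is the witness for Robinson's CQ.\<close>
  moreover have "total_derivative G xbar (t *\<^sub>R d) = t *\<^sub>R G' d"
    using total_derivative_eq [OF G'] has_derivative_bounded_linear [OF G']
    by (simp add: linear_simps)
  ultimately show ?thesis
    unfolding robinson_cq_def A_def by metis
qed

end
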